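(* Let $\mathbb{F}$ be a finite field, let $m,n\ge 1$ be integers, and let $A\in\mathbb{F}^{m\times m}$ and $B\in\mathbb{F}^{n\times n}$ have characteristic polynomials that are irreducible over $\mathbb{F}$. Then the following are equivalent: (1) for every nonzero $S\in\mathbb{F}^{m\times n}$, the $\mathbb{F}$-linear span of $\{A^iSB^j : i,j\ge 0\}$ equals $\mathbb{F}^{m\times n}$; (2) $\gcd(m,n)=1$.
   Context: The characteristic polynomial of a square matrix $M$ is $\det(sI-M)$. *)

theory Defs
  imports
    "Jordan_Normal_Form.Char_Poly"
    "Jordan_Normal_Form.VS_Connect"
begin

(* Linear span inside the vector space of m x n matrices over the field 'a.  The locale
   matrix_vs makes the pair (class_ring, module_mat TYPE('a) m n) a vectorspace, so
   this is the library span; it contains only carrier_mat m n matrices when T does. *)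
abbreviation mat_span :: "nat \<Rightarrow> nat \<Rightarrow> 'a :: field mat set \<Rightarrow> 'a mat set" where
  "mat_span m n T \<equiv> LinearCombinations.module.span class_ring (module_mat TYPE('a) m n) T"

end

theory Submission
  imports Defs "HOL-Library.Function_Algebras" "HOL-Library.Cardinality" "HOL-Algebra.Sylow"
begin

text \<open>
  Let \<open>q = |F|\<close>, and let the polynomial ring \<open>F[x][y]\<close> act on the space \<open>V\<close> of \<open>m \<times> n\<close> matrices, \<open>x\<close> by
  left multiplication with \<open>A\<close> and \<open>y\<close> by right multiplication with \<open>B\<close>. The span in question is the
  orbit of \<open>S\<close>. By Cayley--Hamilton it is a vector space over the fields \<open>F[x]/(\<chi>\<^sub>A)\<close> and
  \<open>F[y]/(\<chi>\<^sub>B)\<close>, so its dimension over \<open>F\<close> is divisible by \<open>m\<close> and by \<open>n\<close>; if these are coprime, it is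
  everything. Conversely, if every nonzero orbit is \<open>V\<close>, then the annihilator \<open>I\<close> of a nonzero \<open>S\<close> is
  a prime ideal with \<open>F[x][y]/I\<close> in bijection with \<open>V\<close>. With \<open>l = lcm m n\<close>, all elements of this
  domain are roots of \<open>z ^ (q ^ l) - z\<close>, because \<open>x\<close> and \<open>y\<close> are and \<open>z \<mapsto> z ^ q\<close> is additive. Hence
  \<open>q ^ (m n) \<le> q ^ l\<close>, and \<open>m\<close> and \<open>n\<close> are coprime.
\<close>

section \<open>Polynomials over finite fields\<close>

text \<open>The bound is put on the coefficients because \<open>degree 0 = 0\<close>: for
  \<open>m = 0\<close> exactly the zero polynomial remains. Splitting off the constant coefficient
  gives one factor per step.\<close>

lemma card_polys_degree_less:
  "card {p :: 'a :: {finite, zero} poly. \<forall>i\<ge>m. coeff p i = 0} = CARD('a) ^ m"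
proof (induction m)
  case 0
  have "{p :: 'a poly. \<forall>i\<ge>0. coeff p i = 0} = {0}"
    by (auto simp: poly_eq_iff)
  then show ?case by simp
next
  case (Suc m)
  let ?P = "\<lambda>m. {p :: 'a poly. \<forall>i\<ge>m. coeff p i = 0}"
  have "?P (Suc m) = (\<lambda>(a, p). pCons a p) ` (UNIV \<times> ?P m)" (is "_ = ?R")
  proof
    show "?R \<subseteq> ?P (Suc m)"
      by (auto simp: coeff_pCons split: nat.splits)
    show "?P (Suc m) \<subseteq> ?R"
    proof
      fix p assume p: "p \<in> ?P (Suc m)"
      obtain a q where "p = pCons a q"
        by (cases p)
      moreover from this p have "q \<in> ?P m"
        by (auto simp: coeff_pCons split: nat.splits)
      ultimately show "p \<in> ?R" by auto
    qed
  qed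
  moreover have "inj_on (\<lambda>(a, p). pCons a p) (UNIV \<times> ?P m)"
    by (auto simp: inj_on_def)
  ultimately show ?case
    using Suc by (simp add: card_image card_cartesian_product)
qed

lemma finite_polys_degree_less:
  "finite {p :: 'a :: {finite, zero} poly. \<forall>i\<ge>m. coeff p i = 0}"
  by (rule card_ge_0_finite) (simp add: card_polys_degree_less finite_UNIV_card_ge_0)

lemma degree_less_iff_coeff:
  assumes "m > 0"
  shows "degree p < m \<longleftrightarrow> (\<forall>i\<ge>m. coeff p i = 0)"
proof
  assume "degree p < m"
  then show "\<forall>i\<ge>m. coeff p i = 0"
    by (auto intro: coeff_eq_0)
next
  assume *: "\<forall>i\<ge>m. coeff p i = 0"
  show "degree p < m"
  proof (rule ccontr)
    assume "\<not> degree p < m"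
    with * have "coeff p (degree p) = 0" by simp
    with assms \<open>\<not> degree p < m\<close> show False by simp
  qed
qed

lemma irreducible_degree_pos:
  fixes f :: "'a :: field poly"
  assumes "Factorial_Ring.irreducible f"
  shows "degree f > 0"
  using assms by (auto simp: Factorial_Ring.irreducible_def is_unit_iff_degree)

lemma finite_field_two_le_card: "2 \<le> CARD('a :: {finite, field})"
proof -
  have "card {0, 1 :: 'a} \<le> CARD('a)"
    by (rule card_mono) auto
  then show ?thesis by simp
qed

text \<open>Fermat's argument in the residue field: multiplication by \<open>f\<close> permutes the
  nonzero residues modulo \<chi>, represented by the set \<open>G\<close> of polynomials of lower
  degree. Comparing products over \<open>G\<close> and cancelling \<open>\<Prod>G\<close> gives the
  claim.\<close>

lemma irreducible_poly_fermat:
  fixes f \<chi> :: "'a :: {finite, field} poly"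
  assumes irr: "Factorial_Ring.irreducible \<chi>" and nd: "\<not> \<chi> dvd f"
  shows "\<chi> dvd f ^ (CARD('a) ^ degree \<chi> - 1) - 1"
proof -
  let ?m = "degree \<chi>"
  define P where "P = {p :: 'a poly. \<forall>i\<ge>?m. coeff p i = 0}"
  have m: "?m > 0" using irr by (rule irreducible_degree_pos)
  have P_iff: "p \<in> P \<longleftrightarrow> degree p < ?m" for p
    using degree_less_iff_coeff[OF m, of p] by (simp add: P_def)
  have fin: "finite P" and cardP: "card P = CARD('a) ^ ?m"
    unfolding P_def by (rule finite_polys_degree_less, rule card_polys_degree_less)
  have pr: "prime_elem \<chi>"
    using irr by (rule field_poly_irreducible_imp_prime)
  define G where "G = P - {0}"
  have G_nd: "\<not> \<chi> dvd p" if "p \<in> G" for p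
    using that dvd_imp_degree_le[of \<chi> p] by (auto simp: G_def P_iff)
  define h where "h p = (f * p) mod \<chi>" for p
  have hG: "h p \<in> G" if "p \<in> G" for p
  proof -
    have "\<not> \<chi> dvd f * p"
      using nd G_nd[OF that] pr by (simp add: prime_elem_dvd_mult_iff)
    then have "h p \<noteq> 0" by (simp add: h_def dvd_eq_mod_eq_0)
    moreover have "degree (h p) < ?m"
      unfolding h_def using m degree_mod_less'[of \<chi> "f * p"] by fastforce
    ultimately show ?thesis by (simp add: G_def P_iff)
  qed
  have inj: "inj_on h G"
  proof (rule inj_onI)
    fix p p' assume p: "p \<in> G" "p' \<in> G" "h p = h p'"
    then have "\<chi> dvd f * p - f * p'"
      by (simp add: h_def mod_eq_dvd_iff)
    then have "\<chi> dvd f * (p - p')" by (simp add: algebra_simps)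
    then have "\<chi> dvd p - p'" using nd pr by (simp add: prime_elem_dvd_mult_iff)
    moreover have "degree (p - p') < ?m"
      using p by (auto simp: G_def P_iff intro: degree_diff_less)
    ultimately show "p = p'"
      using dvd_imp_degree_le[of \<chi> "p - p'"] by (cases "p - p' = 0") auto
  qed
  have finG: "finite G" using fin by (simp add: G_def)
  have img: "h ` G = G"
    using endo_inj_surj[OF finG _ inj] hG by blast
  have "(\<Prod>p\<in>G. f * p) mod \<chi> = (\<Prod>p\<in>G. h p) mod \<chi>"
    unfolding h_def by (rule mod_prod_eq[symmetric])
  moreover have "(\<Prod>p\<in>G. h p) = \<Prod>G"
    using prod.reindex[OF inj, of id] img by simp
  moreover have "(\<Prod>p\<in>G. f * p) = f ^ card G * \<Prod>G"
    by (simp add: prod.distrib)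
  ultimately have "\<chi> dvd f ^ card G * \<Prod>G - \<Prod>G"
    by (simp add: mod_eq_dvd_iff)
  then have "\<chi> dvd (f ^ card G - 1) * \<Prod>G"
    by (simp add: algebra_simps)
  \<comment> \<open>The case wanted is \<open>H = G\<close>; admitting subsets makes finite
    induction possible.\<close>
  moreover have "\<not> \<chi> dvd \<Prod>H" if "H \<subseteq> G" for H
    using finite_subset[OF that finG] that
  proof (induction H rule: finite_induct)
    case empty
    then show ?case using m by simp
  next
    case (insert p H)
    then show ?case
      using G_nd[of p] prime_elem_dvd_multD[OF pr, of p "\<Prod>H"] by auto
  qed
  ultimately have "\<chi> dvd f ^ card G - 1"
    using prime_elem_dvd_multD[OF pr] by blast
  moreover have "card G = CARD('a) ^ ?m - 1"
    unfolding G_def cardP[symmetric] by (rule card_Diff_singleton) (simp add: P_def)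
  ultimately show ?thesis by simp
qed

text \<open>Multiplying Fermat by \<open>f\<close> covers the multiples of \<chi> too. Iterating it
  reaches every multiple of the degree, so that one exponent can serve two polynomials of different
  degrees.\<close>

lemma irreducible_poly_dvd_power_card:
  fixes f \<chi> :: "'a :: {finite, field} poly"
  assumes irr: "Factorial_Ring.irreducible \<chi>"
  shows "\<chi> dvd f ^ (CARD('a) ^ (degree \<chi> * k)) - f"
proof (induction k)
  case (Suc k)
  let ?Q = "CARD('a) ^ degree \<chi>" and ?K = "CARD('a) ^ (degree \<chi> * k)"
  have Q: "?Q > 0" using finite_field_two_le_card[where 'a = 'a] by simp
  have *: "\<chi> dvd g ^ ?Q - g" for g
  proof -
    have "g ^ ?Q = g ^ (?Q - 1) * g"
      by (rule power_minus_mult[symmetric, OF Q])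
    then have "g ^ ?Q - g = (g ^ (?Q - 1) - 1) * g"
      by (simp only: left_diff_distrib mult_1_left)
    then show ?thesis
      using irreducible_poly_fermat[OF irr, of g] by (cases "\<chi> dvd g") (simp_all only: dvd_mult dvd_mult2 not_False_eq_True)
  qed
  have "f ^ (CARD('a) ^ (degree \<chi> * Suc k)) - f = ((f ^ ?K) ^ ?Q - f ^ ?K) + (f ^ ?K - f)"
    by (simp add: power_add power_mult[symmetric] mult.commute)
  with *[of "f ^ ?K"] Suc show ?case by (metis dvd_add)
qed simp

text \<open>A prime \<open>r\<close> dividing the cofactor \<open>x\<close> of the full power of the
  characteristic would, by Sylow, be the order of an additive subgroup. A nonzero \<open>y\<close>
  in it satisfies \<open>r * y = 0\<close>, which makes \<open>r\<close> the characteristic, against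
  the choice of \<open>x\<close>.\<close>

lemma finite_field_card_eq_CHAR_power:
  "\<exists>k. CARD('a :: {finite, field}) = CHAR('a) ^ k"
proof -
  let ?p = "CHAR('a)"
  have p: "prime ?p"
    by (rule prime_CHAR_semidom, rule finite_imp_CHAR_pos) simp
  have "CARD('a) \<noteq> 0" by simp
  then obtain x where x: "CARD('a) = ?p ^ multiplicity ?p CARD('a) * x" "\<not> ?p dvd x"
    using multiplicity_decompose'[of "CARD('a)" ?p] not_prime_unit p by blast
  have "x = 1"
  proof (rule ccontr)
    assume "x \<noteq> 1"
    then obtain r where r: "prime r" "r dvd x"
      using prime_factor_nat by blast
    define G where "G = \<lparr>carrier = (UNIV :: 'a set), monoid.mult = (+), one = (0 :: 'a)\<rparr>"
    interpret G: group G
    proof (rule groupI)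
      fix x assume x: "x \<in> carrier G"
      show "\<exists>y\<in>carrier G. y \<otimes>\<^bsub>G\<^esub> x = \<one>\<^bsub>G\<^esub>"
        by (intro bexI[of _ "-x"]) (auto simp: G_def)
    qed (auto simp: G_def add_ac)
    have "r dvd CARD('a)"
      using r(2) by (subst x(1)) simp
    then obtain c where "order G = r ^ 1 * c"
      by (auto simp: G_def order_def dvd_def)
    then obtain H where H: "subgroup H G" "card H = r"
      using sylow_thm[OF r(1) G.group_axioms, of 1 c] by (auto simp: G_def)
    then have "H \<noteq> {0}" using prime_gt_1_nat[OF r(1)] by auto
    moreover have "0 \<in> H"
      using subgroup.one_closed[OF H(1)] by (simp add: G_def)
    ultimately obtain y where y: "y \<in> H" "y \<noteq> 0" by blast
    have fin: "finite H" using H(2) prime_gt_0_nat[OF r(1)] by (simp add: card_ge_0_finite)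
    have "y + h \<in> H" if "h \<in> H" for h
      using subgroup.m_closed[OF H(1) y(1) that] by (simp add: G_def)
    \<comment> \<open>Translation by \<open>y\<close> permutes \<open>H\<close>, so the sums over
      \<open>H\<close> before and after it agree, and their difference is
      \<open>r * y\<close>.\<close>
    then have "(\<lambda>h. y + h) ` H = H"
      by (intro endo_inj_surj fin) auto
    moreover have "inj_on (\<lambda>h. y + h) H" by simp
    ultimately have "(\<Sum>h\<in>H. y + h) = \<Sum>H"
      using sum.reindex[of "\<lambda>h. y + h" H id] by simp
    then have "of_nat r * y = 0"
      by (simp add: sum.distrib H(2))
    then have "?p dvd r"
      using y by (simp add: of_nat_eq_0_iff_char_dvd)
    with r p have "?p = r" by (simp add: primes_dvd_imp_eq)
    with r x show False by simp
  qed
  with x show ?thesis by (metis mult.right_neutral)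
qed

text \<open>The exponent is a power of the characteristic, which \<open>F[x][y]\<close> shares with
  \<open>F\<close>.\<close>

lemma power_card_add:
  fixes r r' :: "'a :: {finite, field} poly poly"
  shows "(r + r') ^ (CARD('a) ^ k) = r ^ (CARD('a) ^ k) + r' ^ (CARD('a) ^ k)"
proof -
  obtain j where "CARD('a) = CHAR('a) ^ j"
    using finite_field_card_eq_CHAR_power by blast
  moreover have "prime CHAR('a)"
    by (rule prime_CHAR_semidom, rule finite_imp_CHAR_pos) simp
  ultimately show ?thesis
    by (intro freshmans_dream'[where n = "j * k"]) (simp_all add: power_mult)
qed

text \<open>This bounds the number of roots by the degree in the quotient by \<open>I\<close>,
  without forming the quotient: \<open>T\<close> holds pairwise incongruent elements. Synthetic
  division removes one root, and primality keeps the others as roots of the quotient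
  polynomial.\<close>

lemma prime_ideal_root_bound:
  fixes I :: "'r :: comm_ring_1 set"
  assumes diff: "\<And>a b. a \<in> I \<Longrightarrow> b \<in> I \<Longrightarrow> a - b \<in> I"
    and mult: "\<And>a r. a \<in> I \<Longrightarrow> r * a \<in> I"
    and prime: "\<And>a b. a * b \<in> I \<Longrightarrow> a \<in> I \<or> b \<in> I"
    and "\<And>x y. x \<in> T \<Longrightarrow> y \<in> T \<Longrightarrow> x \<noteq> y \<Longrightarrow> x - y \<notin> I"
    and "\<And>x. x \<in> T \<Longrightarrow> poly p x \<in> I"
    and "degree p < card T"
  shows "coeff p i \<in> I"
  using assms(4-)
proof (induction "degree p" arbitrary: p T i)
  case 0
  then obtain a where p: "p = [:a:]" by (metis degree_0_id)
  from 0 obtain x where "x \<in> T" by fastforce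
  with 0 p have a: "a \<in> I" by auto
  with mult[of a 0] show ?case
    by (cases i) (simp_all add: p)
next
  case (Suc d)
  from Suc obtain x where x: "x \<in> T" by fastforce
  define q where "q = synthetic_div p x"
  have eq: "p + Polynomial.smult x q = pCons (poly p x) q"
    unfolding q_def by (rule synthetic_div_correct)
  have deg: "d = degree q"
    using Suc.hyps(2) degree_synthetic_div[of p x] by (simp add: q_def)
  have "coeff q j \<in> I" for j
  proof (rule Suc.hyps(1)[OF deg, of "T - {x}"])
    show "degree q < card (T - {x})"
      using Suc.prems(3) Suc.hyps(2) x deg by (simp add: card_Diff_singleton)
    fix y assume y: "y \<in> T - {x}"
    have "(y - x) * poly q y = poly p y - poly p x"
      using arg_cong[OF eq, of "\<lambda>p. poly p y"] by (simp add: algebra_simps)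
    moreover have "poly p y - poly p x \<in> I"
      using y x Suc.prems(2) by (intro diff) auto
    ultimately have "y - x \<in> I \<or> poly q y \<in> I"
      using prime by metis
    with y x Suc.prems(1) show "poly q y \<in> I" by auto
  qed (use Suc.prems(1) in auto)
  then have "coeff (pCons (poly p x) q) i \<in> I"
    using Suc.prems(2)[OF x] by (cases i) simp_all
  moreover have "coeff p i = coeff (pCons (poly p x) q) i - x * coeff q i"
    using arg_cong[OF eq, of "\<lambda>p. coeff p i"] by (simp add: algebra_simps)
  ultimately show ?case
    using diff mult \<open>\<And>j. coeff q j \<in> I\<close> by simp
qed

section \<open>Polynomials acting through an endomorphism\<close>

text \<open>Horner evaluation at the endomorphism \<open>t\<close>. Coefficients from any
  commutative ring allow iteration: \<open>F[x][y]\<close> acts with \<open>F[x]\<close> as its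
  coefficient ring.\<close>

definition poly_act :: "('r :: comm_ring_1 \<Rightarrow> 'b \<Rightarrow> 'b) \<Rightarrow> ('b \<Rightarrow> 'b) \<Rightarrow> 'r poly \<Rightarrow> 'b \<Rightarrow> 'b :: ab_group_add"
  where "poly_act s t p v = fold_coeffs (\<lambda>a w. s a v + t w) p 0"

locale module_endo = Modules.module s
  for s :: "'r :: comm_ring_1 \<Rightarrow> 'b :: ab_group_add \<Rightarrow> 'b" +
  fixes t :: "'b \<Rightarrow> 'b"
  assumes t_add: "t (x + y) = t x + t y"
    and t_scale: "t (s a x) = s a (t x)"
begin

sublocale t: additive t
  by standard (rule t_add)

abbreviation act where "act \<equiv> poly_act s t"

lemma act_0 [simp]: "act 0 v = 0"
  by (simp add: poly_act_def)

lemma act_pCons [simp]: "act (pCons a p) v = s a v + t (act p v)"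
proof (cases "p = 0 \<and> a = 0")
  case True
  then show ?thesis by (simp add: t.zero)
next
  case False
  then show ?thesis
    by (auto simp: poly_act_def fold_coeffs_pCons_coeff_not_0_eq fold_coeffs_pCons_not_0_0_eq t.zero)
qed

lemma act_add: "act (p + q) v = act p v + act q v"
  by (induction p q rule: poly_induct2) (simp_all add: scale_left_distrib t_add algebra_simps)

lemma act_add_right: "act p (v + w) = act p v + act p w"
  by (induction p) (simp_all add: scale_right_distrib t_add algebra_simps)

lemma act_smult: "act (Polynomial.smult a p) v = s a (act p v)"
  by (induction p) (simp_all add: scale_right_distrib t_scale)

lemma act_scale: "act p (s c v) = s c (act p v)"
  by (induction p) (simp_all add: scale_right_distrib t_scale mult.commute)

lemma act_additive_commute:
  assumes "\<And>x y. u (x + y) = u x + u y" and "\<And>a x. u (s a x) = s a (u x)"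
    and "\<And>x. u (t x) = t (u x)"
  shows "u (act p v) = act p (u v)"
proof -
  interpret u: additive u by standard (rule assms)
  show ?thesis
    by (induction p) (simp_all add: assms u.zero)
qed

lemma act_mult: "act (p * q) v = act p (act q v)"
  by (induction p) (simp_all add: act_add act_smult)

sublocale act: Modules.module act
  by standard (simp_all add: act_add act_add_right act_mult one_pCons t.zero)

text \<open>The iteration step: an endomorphism commuting with \<open>t\<close> is linear over the
  polynomials acting through \<open>t\<close>.\<close>

lemma module_endo_act:
  assumes "\<And>x y. u (x + y) = u x + u y" and "\<And>a x. u (s a x) = s a (u x)"
    and "\<And>x. u (t x) = t (u x)"
  shows "module_endo act u"
  by standard (use assms act_additive_commute[of u] in auto)

lemma act_monom_power: "act ([:0, 1:] ^ k) v = (t ^^ k) v"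
  by (induction k) (simp_all add: act_mult t.zero)

lemma act_closed:
  assumes "subspace U" and "\<And>x. x \<in> U \<Longrightarrow> t x \<in> U" and "v \<in> U"
  shows "act p v \<in> U"
  by (induction p) (simp_all add: assms subspace_0 subspace_add subspace_scale)

end

text \<open>Cayley--Hamilton: the adjugate of \<open>x I - A\<close> turns the relations
  \<open>\<Sum>i. (x \<delta>\<^sub>i\<^sub>k - A\<^sub>i\<^sub>k) e\<^sub>i = 0\<close> into \<open>det (x I - A) e\<^sub>l = 0\<close>.\<close>

lemma (in module_endo) act_char_poly_eq_0:
  assumes A: "A \<in> carrier_mat m m"
    and e: "\<And>k. k < m \<Longrightarrow> t (e k) = (\<Sum>i<m. s (A $$ (i, k)) (e i))"
    and l: "l < m"
  shows "act (char_poly A) (e l) = 0"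
proof -
  define C where "C = char_poly_matrix A"
  define D where "D = adj_mat C"
  have C: "C \<in> carrier_mat m m" using A by (simp add: C_def)
  note D = adj_mat[OF C, folded D_def]
  have C_entry: "C $$ (i, k) = (if i = k then [:0, 1:] else 0) + [:- A $$ (i, k):]"
    if "i < m" "k < m" for i k
    using that A by (simp add: C_def char_poly_matrix_def)
  have rel: "(\<Sum>i<m. act (C $$ (i, k)) (e i)) = 0" if k: "k < m" for k
  proof -
    have "(\<Sum>i<m. act (C $$ (i, k)) (e i)) = (\<Sum>i<m. (if i = k then t (e k) else 0) - s (A $$ (i, k)) (e i))"
      by (rule sum.cong) (auto simp: C_entry k act_add t.zero)
    also have "\<dots> = t (e k) - (\<Sum>i<m. s (A $$ (i, k)) (e i))"
      using k by (simp add: sum_subtractf)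
    finally show ?thesis by (simp add: e[OF k])
  qed
  have "act (char_poly A) (e l) = (\<Sum>i<m. act ((C * D) $$ (i, l)) (e i))"
  proof -
    have "(\<Sum>i<m. act ((C * D) $$ (i, l)) (e i)) = (\<Sum>i<m. if i = l then act (det C) (e l) else 0)"
      unfolding D(2) by (rule sum.cong) (auto simp: l)
    then show ?thesis
      using l by (simp add: char_poly_def C_def)
  qed
  \<comment> \<open>The factors are swapped so that \<open>D\<close> acts last, outside the sums
    that \<open>rel\<close> makes vanish.\<close>
  also have "\<dots> = (\<Sum>i<m. act (\<Sum>k<m. D $$ (k, l) * C $$ (i, k)) (e i))"
    by (rule sum.cong) (use C D(1) l in \<open>auto simp: scalar_prod_def atLeast0LessThan mult.commute\<close>)
  also have "\<dots> = (\<Sum>i<m. \<Sum>k<m. act (D $$ (k, l)) (act (C $$ (i, k)) (e i)))"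
    by (simp only: act.scale_sum_left act_mult)
  also have "\<dots> = (\<Sum>k<m. \<Sum>i<m. act (D $$ (k, l)) (act (C $$ (i, k)) (e i)))"
    by (rule sum.swap)
  also have "\<dots> = (\<Sum>k<m. act (D $$ (k, l)) (\<Sum>i<m. act (C $$ (i, k)) (e i)))"
    by (simp only: act.scale_sum_right)
  also have "\<dots> = 0"
    by (simp add: rel)
  finally show ?thesis .
qed

text \<open>The subspace \<open>W\<close> is a vector space over the field \<open>F[x]/(\<chi>)\<close>, with the indeterminate acting
  as \<open>t\<close>; the proof adjoins one basis vector after the other.\<close>

lemma card_stable_subspace:
  fixes s :: "'a :: {finite, field} \<Rightarrow> 'b :: ab_group_add \<Rightarrow> 'b"
  assumes "module_endo s t"
    and irr: "Factorial_Ring.irreducible \<chi>"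
    and W: "module.subspace s W" "\<And>w. w \<in> W \<Longrightarrow> t w \<in> W" "finite W"
    and ann: "\<And>w. w \<in> W \<Longrightarrow> poly_act s t \<chi> w = 0"
  shows "\<exists>k. card W = CARD('a) ^ (degree \<chi> * k)"
proof -
  interpret module_endo s t by fact
  let ?m = "degree \<chi>"
  \<comment> \<open>\<open>A\<close> collects the stable subspaces of \<open>W\<close> whose size
    already has the desired form; a largest one turns out to be \<open>W\<close>.\<close>
  define A where "A U \<longleftrightarrow> subspace U \<and> (\<forall>u\<in>U. t u \<in> U) \<and> U \<subseteq> W \<and>
    (\<exists>k. card U = CARD('a) ^ (?m * k))" for U
  have "A {0}"
    using W(1) by (auto simp: A_def t.zero subspace_0 intro!: exI[of _ 0])
  moreover have "\<forall>U. A U \<longrightarrow> card U \<le> card W"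
    using W(3) by (auto simp: A_def intro: card_mono)
  ultimately obtain U where AU: "A U" and max: "\<And>U'. A U' \<Longrightarrow> card U' \<le> card U"
    using ex_has_greatest_nat[of A "{0}" card "Suc (card W)"] by (metis less_Suc_eq_le)
  have U: "subspace U" "\<And>u. u \<in> U \<Longrightarrow> t u \<in> U" "U \<subseteq> W"
    using AU by (auto simp: A_def)
  from AU obtain k where k: "card U = CARD('a) ^ (?m * k)"
    by (auto simp: A_def)
  have "W \<subseteq> U"
  proof
    fix x assume x: "x \<in> W"
    show "x \<in> U"
    proof (rule ccontr)
      assume x': "x \<notin> U"
      define P where "P = {p :: 'a poly. \<forall>i\<ge>?m. coeff p i = 0}"
      have m: "?m > 0" using irr by (rule irreducible_degree_pos)
      have P_iff: "p \<in> P \<longleftrightarrow> degree p < ?m" for p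
        using degree_less_iff_coeff[OF m, of p] by (simp add: P_def)
      \<comment> \<open>The stable subspace generated by \<open>U\<close> and \<open>x\<close>.
        Restricting the coefficients to residues modulo \<chi> makes the representation
        unique.\<close>
      define U' where "U' = (\<lambda>(u, p). u + act p x) ` (U \<times> P)"
      have U'I: "u + act p x \<in> U'" if "u \<in> U" for u p
      proof -
        have "p mod \<chi> \<in> P"
          using m degree_mod_less'[of \<chi> p] by (fastforce simp: P_iff)
        moreover have "act p x = act (p mod \<chi>) x"
        proof -
          have "act p x = act (p div \<chi> * \<chi> + p mod \<chi>) x" by simp
          also have "\<dots> = act (p mod \<chi>) x"
            by (simp only: act_add act_mult ann[OF x] act.scale_zero_right add_0)
          finally show ?thesis .
        qed
        ultimately show ?thesis using that by (auto simp: U'_def)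
      qed
      have inj: "inj_on (\<lambda>(u, p). u + act p x) (U \<times> P)"
      proof (rule inj_onI, clarify)
        fix u p u' p'
        assume *: "u \<in> U" "p \<in> P" "u' \<in> U" "p' \<in> P" "u + act p x = u' + act p' x"
        have "p = p'"
        proof (rule ccontr)
          assume "p \<noteq> p'"
          \<comment> \<open>By Fermat, \<open>?d ^ (?e - 1)\<close> inverts \<open>?d\<close> modulo
            \<chi>. Applied to \<open>act ?d x = u' - u\<close>, it recovers \<open>x\<close> as an
            element of \<open>U\<close>.\<close>
          let ?d = "p - p'" and ?e = "CARD('a) ^ ?m - 1"
          have "degree ?d < ?m" using * by (simp add: P_iff degree_diff_less)
          with \<open>p \<noteq> p'\<close> have "\<not> \<chi> dvd ?d"
            using dvd_imp_degree_le[of \<chi> ?d] by auto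
          then have "\<chi> dvd ?d ^ ?e - 1"
            by (rule irreducible_poly_fermat[OF irr])
          then obtain w where w: "?d ^ ?e = w * \<chi> + 1"
            by (auto simp: dvd_def diff_eq_eq mult.commute)
          have "CARD('a) ^ 1 \<le> CARD('a) ^ ?m"
            by (rule power_increasing) (use m finite_field_two_le_card[where 'a = 'a] in auto)
          then have "?e > 0" using finite_field_two_le_card[where 'a = 'a] by simp
          then have "?d ^ ?e = ?d ^ (?e - 1) * ?d"
            by (rule power_minus_mult[symmetric])
          then have "act (?d ^ (?e - 1)) (act ?d x) = act (w * \<chi> + 1) x"
            by (simp only: w act_mult[symmetric])
          also have "\<dots> = x"
            by (simp only: act_add act_mult ann[OF x] act.scale_zero_right act.scale_one add_0)
          finally have "x = act (?d ^ (?e - 1)) (act ?d x)" ..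
          moreover have "act ?d x = u' - u"
            using *(5) by (simp add: act.scale_left_diff_distrib algebra_simps)
          ultimately have "x \<in> U"
            using act_closed[OF U(1,2) subspace_diff[OF U(1) *(3,1)]] by simp
          with x' show False by simp
        qed
        with * show "u = u' \<and> p = p'" by simp
      qed
      have "card U' = card U * card P"
        unfolding U'_def by (simp add: card_image[OF inj] card_cartesian_product)
      then have card: "card U' = CARD('a) ^ (?m * Suc k)"
        by (simp add: k P_def card_polys_degree_less power_add)
      have "A U'"
        unfolding A_def
      proof (intro conjI ballI exI[of _ "Suc k"])
        show "subspace U'"
        proof (rule subspaceI)
          show "0 \<in> U'" using U'I[of 0 0] U(1) by (simp add: subspace_0)
          fix c y z assume "y \<in> U'"
          then obtain u p where y: "y = u + act p x" "u \<in> U" by (auto simp: U'_def)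
          show "s c y \<in> U'"
            using U'I[of "s c u" "Polynomial.smult c p"] y U(1)
            by (simp add: scale_right_distrib act_smult subspace_scale)
          assume "z \<in> U'"
          then obtain u' p' where z: "z = u' + act p' x" "u' \<in> U" by (auto simp: U'_def)
          show "y + z \<in> U'"
            using U'I[of "u + u'" "p + p'"] y z U(1)
            by (simp add: act_add subspace_add algebra_simps)
        qed
        show "U' \<subseteq> W"
          using U(3) act_closed[OF W(1,2) x] W(1) by (auto simp: U'_def intro!: subspace_add)
        show "card U' = CARD('a) ^ (?m * Suc k)" by fact
        fix y assume "y \<in> U'"
        then obtain u p where y: "y = u + act p x" "u \<in> U" by (auto simp: U'_def)
        show "t y \<in> U'"
          using U'I[of "t u" "pCons 0 p"] y U(2) by (simp add: t_add)
      qed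
      then have "card U' \<le> card U" by (rule max)
      then have "?m * Suc k \<le> ?m * k"
        using finite_field_two_le_card[where 'a = 'a] by (simp add: k card power_increasing_iff del: mult_Suc_right)
      with m show False by simp
    qed
  qed
  with U(3) k show ?thesis by auto
qed

section \<open>Two commuting endomorphisms\<close>

text \<open>Abstracts left multiplication by \<open>A\<close> and right multiplication by
  \<open>B\<close>. The cardinality of \<open>V\<close> encodes its dimension, and annihilation is
  required on \<open>V\<close>, which may be smaller than the type.\<close>

locale commuting_endos =
  A: module_endo s \<alpha> + B: module_endo s \<beta>
  for s :: "'a :: {finite, field} \<Rightarrow> 'b :: ab_group_add \<Rightarrow> 'b" and \<alpha> \<beta> +
  fixes V :: "'b set" and \<chi> \<psi> :: "'a poly"
  assumes commute: "\<beta> (\<alpha> x) = \<alpha> (\<beta> x)"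
    and V: "A.subspace V" "\<And>x. x \<in> V \<Longrightarrow> \<alpha> x \<in> V" "\<And>x. x \<in> V \<Longrightarrow> \<beta> x \<in> V"
    and card_V: "card V = CARD('a) ^ (degree \<chi> * degree \<psi>)"
    and irr: "Factorial_Ring.irreducible \<chi>" "Factorial_Ring.irreducible \<psi>"
    and ann: "\<And>x. x \<in> V \<Longrightarrow> poly_act s \<alpha> \<chi> x = 0" "\<And>x. x \<in> V \<Longrightarrow> poly_act s \<beta> \<psi> x = 0"
begin

sublocale AB: module_endo "poly_act s \<alpha>" \<beta>
  by (rule A.module_endo_act) (simp_all add: B.t_add B.t_scale commute)

abbreviation biact :: "'a poly poly \<Rightarrow> 'b \<Rightarrow> 'b" where
  "biact \<equiv> poly_act (poly_act s \<alpha>) \<beta>"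

lemma two_le_card: "2 \<le> CARD('a)"
  by (rule finite_field_two_le_card)

lemma deg_pos: "degree \<chi> > 0" "degree \<psi> > 0"
  using irr by (auto intro: irreducible_degree_pos)

lemma finite_V: "finite V"
  by (rule card_ge_0_finite) (simp add: card_V)

lemma biact_closed:
  assumes "A.subspace U" "\<And>x. x \<in> U \<Longrightarrow> \<alpha> x \<in> U" "\<And>x. x \<in> U \<Longrightarrow> \<beta> x \<in> U" "v \<in> U"
  shows "biact r v \<in> U"
  by (rule AB.act_closed)
    (auto simp: A.act.subspace_def assms A.act_closed A.subspace_0 A.subspace_add)

lemma biact_V: "v \<in> V \<Longrightarrow> biact r v \<in> V"
  by (intro biact_closed V)

lemma scale_biact: "s c (biact r v) = biact (Polynomial.smult [:c:] r) v"
  by (simp add: AB.act_smult A.t.zero)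

lemma alpha_biact: "\<alpha> (biact r v) = biact (Polynomial.smult [:0, 1:] r) v"
  by (simp add: AB.act_smult A.t.zero)

lemma beta_biact: "\<beta> (biact r v) = biact (pCons 0 r) v"
  by simp

lemma coprime_imp_transitive:
  assumes gcd: "gcd (degree \<chi>) (degree \<psi>) = 1" and v: "v \<in> V" "v \<noteq> 0"
  shows "range (\<lambda>r. biact r v) = V"
proof -
  define W where "W = range (\<lambda>r. biact r v)"
  have WV: "W \<subseteq> V" using v biact_V by (auto simp: W_def)
  then have fin: "finite W" using finite_V finite_subset by blast
  have W: "biact r v \<in> W" for r by (simp add: W_def)
  have sub: "A.subspace W"
  proof (rule A.subspaceI)
    show "0 \<in> W" using W[of 0] by simp
    show "x + y \<in> W" if "x \<in> W" "y \<in> W" for x y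
      using that by (auto simp: W_def AB.act_add[symmetric])
    show "s c x \<in> W" if "x \<in> W" for c x
      using that by (auto simp: W_def scale_biact)
  qed
  have cl: "\<alpha> x \<in> W" "\<beta> x \<in> W" if "x \<in> W" for x
    using that W by (auto simp: W_def alpha_biact beta_biact simp del: AB.act_pCons)
  obtain k where k: "card W = CARD('a) ^ (degree \<chi> * k)"
    using card_stable_subspace[OF A.module_endo_axioms irr(1) sub cl(1) fin ann(1)] WV by blast
  obtain l where l: "card W = CARD('a) ^ (degree \<psi> * l)"
    using card_stable_subspace[OF B.module_endo_axioms irr(2) sub cl(2) fin ann(2)] WV by blast
  from k l have eq: "degree \<chi> * k = degree \<psi> * l"
    using two_le_card by (simp add: power_inject_exp)
  \<comment> \<open>The orbit contains both \<open>0\<close> and \<open>v\<close>, so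
    \<open>k\<close> is positive and its divisibility by \<open>degree \<psi>\<close> bounds it from
    below.\<close>
  have "card {0, v} \<le> card W"
    using fin W[of 0] W[of 1] by (intro card_mono) auto
  with v k have "k > 0" by (cases k) auto
  moreover from eq have "degree \<psi> dvd degree \<chi> * k" by simp
  with gcd have "degree \<psi> dvd k"
    by (metis coprime_dvd_mult_right_iff coprime_iff_gcd_eq_1 gcd.commute)
  ultimately have "degree \<chi> * degree \<psi> \<le> degree \<chi> * k"
    by (simp add: dvd_imp_le)
  then have "card V \<le> card W"
    using two_le_card by (simp add: k card_V power_increasing)
  with WV finite_V show ?thesis
    unfolding W_def[symmetric] by (intro card_seteq) auto
qed

lemma transitive_imp_coprime:
  assumes trans: "\<And>v. v \<in> V \<Longrightarrow> v \<noteq> 0 \<Longrightarrow> range (\<lambda>r. biact r v) = V"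
  shows "gcd (degree \<chi>) (degree \<psi>) = 1"
proof -
  have "CARD('a) ^ 1 \<le> card V"
    unfolding card_V by (rule power_increasing) (use deg_pos two_le_card in auto)
  with two_le_card have "card V > 1" by simp
  then have "V \<noteq> {0}" by auto
  with A.subspace_0[OF V(1)] obtain v where v: "v \<in> V" "v \<noteq> 0" by blast
  define I where "I = {r. biact r v = 0}"
  \<comment> \<open>A common multiple of the degrees makes the \<open>Q\<close>-th power the
    identity modulo \<chi> and modulo \<psi>; the least one gives the bound that forces
    coprimality.\<close>
  define l where "l = lcm (degree \<chi>) (degree \<psi>)"
  define Q where "Q = CARD('a) ^ l"
  have "l > 0" using deg_pos by (simp add: l_def lcm_pos_nat)
  then have "CARD('a) ^ 1 \<le> Q"
    unfolding Q_def by (intro power_increasing) (use two_le_card in auto)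
  with two_le_card have Q2: "2 \<le> Q" by simp
  have I_add: "a + b \<in> I" if "a \<in> I" "b \<in> I" for a b
    using that by (simp add: I_def AB.act_add)
  have I_diff: "a - b \<in> I" if "a \<in> I" "b \<in> I" for a b
    using that by (simp add: I_def AB.act.scale_left_diff_distrib)
  have I_mult: "r * a \<in> I" if "a \<in> I" for a r
    using that by (simp add: I_def AB.act_mult)
  have I_prime: "a \<in> I \<or> b \<in> I" if ab: "a * b \<in> I" for a b
  proof (rule disjCI)
    \<comment> \<open>The vector \<open>biact b v\<close> is nonzero, so its orbit reaches back to
      \<open>v\<close>; hence \<open>a\<close> acts on \<open>v\<close> as a multiple of
      \<open>a * b\<close> does.\<close>
    assume "b \<notin> I"
    then have "range (\<lambda>r. biact r (biact b v)) = V"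
      using v biact_V by (intro trans) (auto simp: I_def)
    with v obtain u where u: "v = biact u (biact b v)" by blast
    have "biact a v = biact a (biact u (biact b v))"
      using u by simp
    also have "\<dots> = biact (u * (a * b)) v"
      by (simp only: AB.act_mult[symmetric] mult_ac)
    also have "\<dots> = 0"
      using I_mult[OF ab, of u] by (simp add: I_def)
    finally show "a \<in> I" by (simp add: I_def)
  qed
  have const: "[:f:] ^ Q - [:f:] \<in> I" for f
  proof -
    obtain k where "l = degree \<chi> * k" by (metis dvd_lcm1 dvdE l_def)
    then obtain g where "f ^ Q - f = g * \<chi>"
      using irreducible_poly_dvd_power_card[OF irr(1), of f k] by (auto simp: Q_def dvd_def mult.commute)
    then have "poly_act s \<alpha> (f ^ Q - f) v = 0"
      by (simp add: A.act_mult ann v)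
    moreover have "[:f:] ^ Q - [:f:] = [:f ^ Q - f:]"
      by (simp add: poly_const_pow)
    ultimately show ?thesis
      by (simp add: I_def B.t.zero)
  qed
  have y: "[:0, 1:] ^ Q - [:0, 1:] \<in> I"
  proof -
    obtain k where "l = degree \<psi> * k" by (metis dvd_lcm2 dvdE l_def)
    then obtain g where "[:0, 1:] ^ Q - [:0, 1:] = g * \<psi>"
      using irreducible_poly_dvd_power_card[OF irr(2), of "[:0, 1:]" k]
      by (auto simp: Q_def dvd_def mult.commute)
    then have "poly_act s \<beta> ([:0, 1:] ^ Q - [:0, 1:]) v = 0"
      by (simp add: B.act_mult ann v)
    \<comment> \<open>In \<open>F[y]\<close> and in \<open>F[x][y]\<close> alike, powers of
      \<open>y\<close> act as iterates of \<beta>; this carries the relation over.\<close>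
    then have "(\<beta> ^^ Q) v - \<beta> v = 0"
      by (simp add: B.act.scale_left_diff_distrib B.act_monom_power B.t.zero)
    then show ?thesis
      by (simp add: I_def AB.act.scale_left_diff_distrib AB.act_monom_power B.t.zero)
  qed
  have root: "r ^ Q - r \<in> I" for r
  proof (induction r)
    case 0
    then show ?case using Q2 by (simp add: I_def zero_power)
  next
    case (pCons f r)
    have eq: "pCons f r = [:f:] + [:0, 1:] * r" by simp
    have "pCons f r ^ Q = [:f:] ^ Q + [:0, 1:] ^ Q * r ^ Q"
      unfolding eq Q_def power_card_add by (simp only: power_mult_distrib)
    \<comment> \<open>After the constant term is split off, adding and subtracting
      \<open>y ^ Q * r\<close> separates the relation for \<open>r\<close> from that for the
      indeterminate \<open>y\<close>.\<close>
    then have eq': "pCons f r ^ Q - pCons f r =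
      ([:f:] ^ Q - [:f:]) + ([:0, 1:] ^ Q * (r ^ Q - r) + r * ([:0, 1:] ^ Q - [:0, 1:]))"
      unfolding eq by (simp only: algebra_simps)
    show ?case
      unfolding eq' by (intro I_add I_mult pCons.IH const y)
  qed
  \<comment> \<open>Representatives of the residue classes modulo \<open>I\<close>: the class of
    \<open>r\<close> is determined by the vector \<open>biact r v\<close>.\<close>
  define \<rho> where "\<rho> w = (SOME r. biact r v = w)" for w
  have \<rho>: "biact (\<rho> w) v = w" if "w \<in> V" for w
  proof -
    have "w \<in> range (\<lambda>r. biact r v)" using trans[OF v] that by simp
    then have "\<exists>r. biact r v = w" by auto
    then show ?thesis unfolding \<rho>_def by (rule someI_ex)
  qed
  have "inj_on \<rho> V" by (rule inj_on_inverseI[of _ "\<lambda>r. biact r v"]) (rule \<rho>)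
  then have card: "card (\<rho> ` V) = card V" by (rule card_image)
  \<comment> \<open>The polynomial \<open>z ^ Q - z\<close>, with every element of
    \<open>F[x][y]\<close> as a root modulo \<open>I\<close>.\<close>
  define p :: "'a poly poly poly" where "p = monom 1 Q - monom 1 1"
  have p_le: "degree p \<le> Q"
    unfolding p_def using Q2 by (intro degree_diff_le) (simp_all add: degree_monom_eq)
  have "card V \<le> Q"
  proof (rule ccontr)
    assume "\<not> card V \<le> Q"
    with p_le have deg: "degree p < card (\<rho> ` V)" by (simp add: card)
    have "coeff p Q \<in> I"
    proof (rule prime_ideal_root_bound[OF I_diff I_mult I_prime _ _ deg])
      fix x y assume "x \<in> \<rho> ` V" "y \<in> \<rho> ` V" and neq: "x \<noteq> y"
      then obtain w w' where w: "w \<in> V" "w' \<in> V" "x = \<rho> w" "y = \<rho> w'" by blast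
      have "biact (x - y) v = biact (\<rho> w) v - biact (\<rho> w') v"
        unfolding w(3,4) by (rule AB.act.scale_left_diff_distrib)
      also have "\<dots> = w - w'"
        by (simp only: \<rho> w(1,2))
      finally have "biact (x - y) v = w - w'" .
      moreover have "w \<noteq> w'" using neq w(3,4) by blast
      ultimately show "x - y \<notin> I"
        by (simp add: I_def)
    next
      fix x show "poly p x \<in> I"
        using root[of x] by (simp add: p_def poly_monom)
    qed
    \<comment> \<open>\<open>Q \<ge> 2\<close> keeps the two monomials apart, so the coefficient at
      \<open>Q\<close> is 1; but 1 fixes the nonzero \<open>v\<close>.\<close>
    then have "1 \<in> I" using Q2 by (simp add: p_def)
    with v show False by (simp add: I_def)
  qed
  then have "degree \<chi> * degree \<psi> \<le> l"
    using two_le_card power_le_imp_le_exp[of "CARD('a)" _ l] by (simp add: card_V Q_def)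
  moreover have "gcd (degree \<chi>) (degree \<psi>) * l = degree \<chi> * degree \<psi>"
    unfolding l_def by (rule prod_gcd_lcm_nat[symmetric])
  ultimately have "gcd (degree \<chi>) (degree \<psi>) * l \<le> 1 * l" by simp
  with \<open>l > 0\<close> have "gcd (degree \<chi>) (degree \<psi>) \<le> 1" by simp
  with deg_pos show ?thesis by (simp add: le_Suc_eq)
qed

end

section \<open>Matrices\<close>

text \<open>Together with \<open>mat_span_minimal\<close> this characterizes the span as the least
  subspace containing \<open>T\<close>, so that later arguments avoid explicit linear
  combinations.\<close>

lemma mat_span_closed:
  fixes T :: "'a :: field mat set"
  assumes "T \<subseteq> carrier_mat m n"
  shows mat_span_superset: "T \<subseteq> mat_span m n T"
    and mat_span_carrier: "mat_span m n T \<subseteq> carrier_mat m n"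
    and mat_span_0: "0\<^sub>m m n \<in> mat_span m n T"
    and mat_span_add: "X \<in> mat_span m n T \<Longrightarrow> Y \<in> mat_span m n T \<Longrightarrow> X + Y \<in> mat_span m n T"
    and mat_span_smult: "X \<in> mat_span m n T \<Longrightarrow> c \<cdot>\<^sub>m X \<in> mat_span m n T"
proof -
  interpret vectorspace "class_ring :: 'a ring" "module_mat TYPE('a) m n"
    by (rule matrix_vs)
  have T: "T \<subseteq> carrier (module_mat TYPE('a) m n)"
    using assms by (simp add: module_mat_simps)
  show "T \<subseteq> mat_span m n T" using T by (rule in_own_span)
  interpret S: submodule class_ring "mat_span m n T" "module_mat TYPE('a) m n"
    using T by (rule span_is_submodule)
  show "mat_span m n T \<subseteq> carrier_mat m n"
    using S.subset by (simp add: module_mat_simps)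
  show "0\<^sub>m m n \<in> mat_span m n T"
    using S.zero_closed by (simp add: module_mat_simps)
  show "X \<in> mat_span m n T \<Longrightarrow> Y \<in> mat_span m n T \<Longrightarrow> X + Y \<in> mat_span m n T"
    using S.m_closed[of X Y] by (simp add: module_mat_simps)
  show "X \<in> mat_span m n T \<Longrightarrow> c \<cdot>\<^sub>m X \<in> mat_span m n T"
    using S.smult_closed[of c X] by (simp add: module_mat_simps class_ring_simps)
qed

lemma mat_span_minimal:
  fixes T :: "'a :: field mat set"
  assumes "T \<subseteq> N" "N \<subseteq> carrier_mat m n" "0\<^sub>m m n \<in> N"
    and "\<And>X Y. X \<in> N \<Longrightarrow> Y \<in> N \<Longrightarrow> X + Y \<in> N" "\<And>c X. X \<in> N \<Longrightarrow> c \<cdot>\<^sub>m X \<in> N"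
  shows "mat_span m n T \<subseteq> N"
proof -
  interpret vectorspace "class_ring :: 'a ring" "module_mat TYPE('a) m n"
    by (rule matrix_vs)
  show ?thesis
    by (rule span_is_subset[OF assms(1)], unfold_locales)
      (use assms in \<open>auto simp: module_mat_simps class_ring_simps\<close>)
qed

lemma sum_fun_apply: "(\<Sum>x\<in>S. f x) y = (\<Sum>x\<in>S. f x y)"
  by (induction S rule: infinite_finite_induct) auto

text \<open>Matrices do not form an instance of \<^class>\<open>ab_group_add\<close>, so they are represented by the
  functions \<open>nat \<Rightarrow> nat \<Rightarrow> 'a\<close> supported on the index rectangle.\<close>

definition scale_fun :: "'a :: comm_ring_1 \<Rightarrow> (nat \<Rightarrow> nat \<Rightarrow> 'a) \<Rightarrow> nat \<Rightarrow> nat \<Rightarrow> 'a" where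
  "scale_fun c f = (\<lambda>i j. c * f i j)"

definition lmult_fun :: "'a :: comm_ring_1 mat \<Rightarrow> (nat \<Rightarrow> nat \<Rightarrow> 'a) \<Rightarrow> nat \<Rightarrow> nat \<Rightarrow> 'a" where
  "lmult_fun A f = (\<lambda>i j. if i < dim_row A then \<Sum>k<dim_col A. A $$ (i, k) * f k j else 0)"

definition rmult_fun :: "'a :: comm_ring_1 mat \<Rightarrow> (nat \<Rightarrow> nat \<Rightarrow> 'a) \<Rightarrow> nat \<Rightarrow> nat \<Rightarrow> 'a" where
  "rmult_fun B f = (\<lambda>i j. if j < dim_col B then \<Sum>k<dim_row B. f i k * B $$ (k, j) else 0)"

definition unit_fun :: "nat \<Rightarrow> nat \<Rightarrow> nat \<Rightarrow> nat \<Rightarrow> 'a :: comm_ring_1" where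
  "unit_fun k l = (\<lambda>i j. if i = k \<and> j = l then 1 else 0)"

lemma module_endo_lmult_fun: "module_endo scale_fun (lmult_fun A)"
  by standard
    (auto simp: fun_eq_iff scale_fun_def lmult_fun_def algebra_simps sum.distrib sum_distrib_left)

lemma module_endo_rmult_fun: "module_endo scale_fun (rmult_fun B)"
  by standard
    (auto simp: fun_eq_iff scale_fun_def rmult_fun_def algebra_simps sum.distrib sum_distrib_left)

lemma lmult_rmult_fun_commute: "rmult_fun B (lmult_fun A f) = lmult_fun A (rmult_fun B f)"
  unfolding fun_eq_iff
proof (intro allI)
  fix i j
  have "(\<Sum>l<dim_row B. (\<Sum>k<dim_col A. A $$ (i, k) * f k l) * B $$ (l, j)) =
    (\<Sum>k<dim_col A. A $$ (i, k) * (\<Sum>l<dim_row B. f k l * B $$ (l, j)))"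
    by (simp add: sum_distrib_left sum_distrib_right mult.assoc) (rule sum.swap)
  then show "rmult_fun B (lmult_fun A f) i j = lmult_fun A (rmult_fun B f) i j"
    by (simp add: lmult_fun_def rmult_fun_def)
qed

section \<open>The actions of \<open>A\<close> and \<open>B\<close> on the matrix space\<close>

locale matrix_pair =
  fixes A B :: "'a :: {finite, field} mat" and m n :: nat
  assumes A: "A \<in> carrier_mat m m" and B: "B \<in> carrier_mat n n"
    and irr_A: "Factorial_Ring.irreducible (char_poly A)"
    and irr_B: "Factorial_Ring.irreducible (char_poly B)"
begin

definition V :: "(nat \<Rightarrow> nat \<Rightarrow> 'a) set" where
  "V = {f. \<forall>i j. m \<le> i \<or> n \<le> j \<longrightarrow> f i j = 0}"

definition to_mat :: "(nat \<Rightarrow> nat \<Rightarrow> 'a) \<Rightarrow> 'a mat" where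
  "to_mat f = mat m n (\<lambda>(i, j). f i j)"

lemma to_mat_carrier [simp]: "to_mat f \<in> carrier_mat m n"
  by (simp add: to_mat_def)

lemma to_mat_dim [simp]: "dim_row (to_mat f) = m" "dim_col (to_mat f) = n"
  by (simp_all add: to_mat_def)

lemma to_mat_index [simp]: "i < m \<Longrightarrow> j < n \<Longrightarrow> to_mat f $$ (i, j) = f i j"
  by (simp add: to_mat_def)

lemma to_mat_0 [simp]: "to_mat 0 = 0\<^sub>m m n"
  by (rule eq_matI) auto

lemma to_mat_add: "to_mat (f + g) = to_mat f + to_mat g"
  by (rule eq_matI) auto

lemma to_mat_scale: "to_mat (scale_fun c f) = c \<cdot>\<^sub>m to_mat f"
  by (rule eq_matI) (auto simp: scale_fun_def)

lemma to_mat_lmult: "to_mat (lmult_fun A f) = A * to_mat f"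
  using A by (intro eq_matI) (auto simp: lmult_fun_def scalar_prod_def atLeast0LessThan)

lemma to_mat_rmult: "to_mat (rmult_fun B f) = to_mat f * B"
  using B by (intro eq_matI) (auto simp: rmult_fun_def scalar_prod_def atLeast0LessThan)

lemma bij_to_mat: "bij_betw to_mat V (carrier_mat m n)"
proof (rule bij_betw_byWitness[where f' = "\<lambda>X i j. if i < m \<and> j < n then X $$ (i, j) else 0"])
  show "\<forall>f\<in>V. (\<lambda>i j. if i < m \<and> j < n then to_mat f $$ (i, j) else 0) = f"
    by (auto simp: V_def fun_eq_iff)
  show "\<forall>X\<in>carrier_mat m n. to_mat (\<lambda>i j. if i < m \<and> j < n then X $$ (i, j) else 0) = X"
    by (auto intro!: eq_matI)
qed (auto simp: V_def)

lemma card_V: "card V = CARD('a) ^ (m * n)"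
proof -
  let ?D = "{..<m} \<times> {..<n}"
  have "bij_betw (\<lambda>f. restrict (\<lambda>(i, j). f i j) ?D) V (PiE ?D (\<lambda>_. UNIV))"
    by (rule bij_betw_byWitness[where f' = "\<lambda>g i j. if i < m \<and> j < n then g (i, j) else 0"])
      (auto simp: V_def fun_eq_iff PiE_def extensional_def)
  then have "card V = card (PiE ?D (\<lambda>_. UNIV :: 'a set))"
    by (rule bij_betw_same_card)
  then show ?thesis
    by (simp add: card_PiE card_cartesian_product)
qed

lemma V_eq_sum:
  assumes "f \<in> V"
  shows "f = (\<Sum>k<m. \<Sum>l<n. scale_fun (f k l) (unit_fun k l))"
  unfolding fun_eq_iff
proof (intro allI)
  fix i j
  have "(\<Sum>k<m. \<Sum>l<n. scale_fun (f k l) (unit_fun k l)) i j =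
    (\<Sum>k<m. \<Sum>l<n. if i = k \<and> j = l then f k l else 0)"
    by (simp add: sum_fun_apply scale_fun_def unit_fun_def if_distrib cong: if_cong)
  also have "\<dots> = (\<Sum>k<m. if i = k then \<Sum>l<n. if j = l then f k l else 0 else 0)"
    by (intro sum.cong) auto
  also have "\<dots> = f i j"
    using assms by (auto simp: V_def)
  finally show "f i j = (\<Sum>k<m. \<Sum>l<n. scale_fun (f k l) (unit_fun k l)) i j" ..
qed

lemma act_eq_0_on_V:
  assumes "module_endo scale_fun t"
    and "\<And>k l. k < m \<Longrightarrow> l < n \<Longrightarrow> poly_act scale_fun t p (unit_fun k l) = 0"
    and "f \<in> V"
  shows "poly_act scale_fun t p f = 0"
proof -
  interpret module_endo scale_fun t by fact
  show ?thesis
    by (subst V_eq_sum[OF assms(3)]) (simp add: act.scale_sum_right act_scale assms(2))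
qed

text \<open>Cayley-Hamilton, column by column and row by row: left multiplication transforms the
  matrix units of one column by \<open>A\<close>, right multiplication those of one row by the
  transpose of \<open>B\<close>, which has the same characteristic polynomial as
  \<open>B\<close>.\<close>

lemma char_poly_annihilates_V:
  assumes "f \<in> V"
  shows "poly_act scale_fun (lmult_fun A) (char_poly A) f = 0"
    and "poly_act scale_fun (rmult_fun B) (char_poly B) f = 0"
proof -
  interpret A: module_endo scale_fun "lmult_fun A" by (rule module_endo_lmult_fun)
  interpret B: module_endo scale_fun "rmult_fun B" by (rule module_endo_rmult_fun)
  show "A.act (char_poly A) f = 0"
  proof (rule act_eq_0_on_V[OF module_endo_lmult_fun _ assms])
    fix k l assume "k < m"
    then show "A.act (char_poly A) (unit_fun k l) = 0"
    proof (rule A.act_char_poly_eq_0[OF A, of "\<lambda>k. unit_fun k l", rotated])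
      fix k assume "k < m"
      then have "lmult_fun A (unit_fun k l) i j = (\<Sum>i<m. scale_fun (A $$ (i, k)) (unit_fun i l)) i j" for i j
        using A by (cases "j = l") (simp_all add: sum_fun_apply lmult_fun_def scale_fun_def unit_fun_def
            if_distrib[of "\<lambda>x. _ * x"] cong: if_cong)
      then show "lmult_fun A (unit_fun k l) = (\<Sum>i<m. scale_fun (A $$ (i, k)) (unit_fun i l))"
        by blast
    qed
  qed
  show "B.act (char_poly B) f = 0"
  proof (rule act_eq_0_on_V[OF module_endo_rmult_fun _ assms])
    fix k l assume "l < n"
    then have "B.act (char_poly (transpose_mat B)) (unit_fun k l) = 0"
    proof (rule B.act_char_poly_eq_0[of _ _ "\<lambda>l. unit_fun k l", rotated 2])
      show "transpose_mat B \<in> carrier_mat n n" using B by simp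
      fix l assume "l < n"
      then have "rmult_fun B (unit_fun k l) i j =
          (\<Sum>j<n. scale_fun (transpose_mat B $$ (j, l)) (unit_fun k j)) i j" for i j
        using B by (cases "i = k") (simp_all add: sum_fun_apply rmult_fun_def scale_fun_def unit_fun_def
            if_distrib[of "\<lambda>x. _ * x"] if_distrib[of "\<lambda>x. x * _"] cong: if_cong)
      then show "rmult_fun B (unit_fun k l) = (\<Sum>j<n. scale_fun (transpose_mat B $$ (j, l)) (unit_fun k j))"
        by blast
    qed
    then show "B.act (char_poly B) (unit_fun k l) = 0"
      using B by simp
  qed
qed

lemma V_closed:
  "0 \<in> V" "f \<in> V \<Longrightarrow> g \<in> V \<Longrightarrow> f + g \<in> V" "f \<in> V \<Longrightarrow> scale_fun c f \<in> V"
  "f \<in> V \<Longrightarrow> lmult_fun A f \<in> V" "f \<in> V \<Longrightarrow> rmult_fun B f \<in> V"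
  using A B by (auto simp: V_def scale_fun_def lmult_fun_def rmult_fun_def intro!: sum.neutral)

sublocale commuting_endos scale_fun "lmult_fun A" "rmult_fun B" V "char_poly A" "char_poly B"
proof -
  interpret A: module_endo scale_fun "lmult_fun A" by (rule module_endo_lmult_fun)
  interpret B: module_endo scale_fun "rmult_fun B" by (rule module_endo_rmult_fun)
  show "commuting_endos scale_fun (lmult_fun A) (rmult_fun B) V (char_poly A) (char_poly B)"
  proof
    show "A.subspace V" using V_closed by (auto simp: A.subspace_def)
    show "card V = CARD('a) ^ (degree (char_poly A) * degree (char_poly B))"
      using degree_monic_char_poly[OF A] degree_monic_char_poly[OF B] by (simp add: card_V)
  qed (fact lmult_rmult_fun_commute V_closed irr_A irr_B char_poly_annihilates_V)+
qed

text \<open>The orbit is a subspace containing all generators. Conversely, the span is stable under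
  both multiplications and contains the image of \<open>f\<close>, hence the image of its
  orbit.\<close>

lemma mat_span_orbit:
  assumes f: "f \<in> V"
  shows "mat_span m n {A ^\<^sub>m i * to_mat f * B ^\<^sub>m j | i j. True} = to_mat ` range (\<lambda>r. biact r f)"
    (is "mat_span m n ?T = to_mat ` ?W")
proof
  have A_pow: "A ^\<^sub>m i \<in> carrier_mat m m" and B_pow: "B ^\<^sub>m i \<in> carrier_mat n n" for i
    using A B by simp_all
  have W: "biact r f \<in> ?W" for r by simp
  \<comment> \<open>Matrix powers grow on the right, so the innermost \<open>A\<close> is absorbed
    into \<open>g\<close>, which therefore varies in the induction.\<close>
  have left: "A ^\<^sub>m i * to_mat g \<in> to_mat ` ?W" if "g \<in> ?W" for g i
    using that
  proof (induction i arbitrary: g)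
    case 0
    then show ?case using A by auto
  next
    case (Suc i)
    have "A ^\<^sub>m Suc i * to_mat g = A ^\<^sub>m i * to_mat (lmult_fun A g)"
      using assoc_mult_mat[OF A_pow A to_mat_carrier] by (simp add: to_mat_lmult)
    moreover have "lmult_fun A g \<in> ?W"
      using Suc.prems by (auto simp: alpha_biact)
    ultimately show ?case using Suc.IH by simp
  qed
  have right: "to_mat g * B ^\<^sub>m j \<in> to_mat ` ?W" if "g \<in> ?W" for g j
    using that
  proof (induction j)
    case 0
    then show ?case using B by auto
  next
    case (Suc j)
    then obtain r where r: "to_mat g * B ^\<^sub>m j = to_mat (biact r f)" by auto
    have "to_mat g * B ^\<^sub>m Suc j = to_mat g * B ^\<^sub>m j * B"
      using assoc_mult_mat[OF to_mat_carrier B_pow B] by simp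
    also have "\<dots> = to_mat (biact (pCons 0 r) f)"
      by (simp only: r to_mat_rmult[symmetric] beta_biact)
    finally show ?case by blast
  qed
  show "mat_span m n ?T \<subseteq> to_mat ` ?W"
  proof (rule mat_span_minimal)
    show "?T \<subseteq> to_mat ` ?W"
    proof clarify
      fix i j
      obtain r where "A ^\<^sub>m i * to_mat f = to_mat (biact r f)"
        using left[of f i] W[of 1] by auto
      then show "A ^\<^sub>m i * to_mat f * B ^\<^sub>m j \<in> to_mat ` ?W"
        using right[OF W] by simp
    qed
    show "0\<^sub>m m n \<in> to_mat ` ?W"
      using W[of 0] to_mat_0 by (metis AB.act_0 imageI)
    show "X + Y \<in> to_mat ` ?W" if "X \<in> to_mat ` ?W" "Y \<in> to_mat ` ?W" for X Y
      using that by (auto simp: to_mat_add[symmetric] AB.act_add[symmetric])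
    show "c \<cdot>\<^sub>m X \<in> to_mat ` ?W" if "X \<in> to_mat ` ?W" for c X
      using that by (auto simp: to_mat_scale[symmetric] scale_biact)
  qed auto
  have T: "?T \<subseteq> carrier_mat m n"
    using mult_carrier_mat[OF mult_carrier_mat[OF A_pow to_mat_carrier] B_pow] by blast
  note span = mat_span_closed[OF T]
  have span_left: "A * X \<in> mat_span m n ?T" if "X \<in> mat_span m n ?T" for X
  proof -
    have A_comm: "A * A ^\<^sub>m i = A ^\<^sub>m Suc i" for i
    proof (induction i)
      case (Suc i)
      then show ?case
        using assoc_mult_mat[OF A A_pow A, of i] by simp
    qed (use A in simp)
    \<comment> \<open>The matrices sent into the span by \<open>A\<close> form a subspace; it
      contains each generator because \<open>A\<close> only raises the exponent
      \<open>i\<close>.\<close>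
    have "mat_span m n ?T \<subseteq> {X \<in> carrier_mat m n. A * X \<in> mat_span m n ?T}" (is "_ \<subseteq> ?N")
    proof (rule mat_span_minimal)
      have eq: "A * (A ^\<^sub>m i * to_mat f * B ^\<^sub>m j) = A ^\<^sub>m Suc i * to_mat f * B ^\<^sub>m j" for i j
        unfolding A_comm[symmetric]
        by (simp only: assoc_mult_mat[OF A mult_carrier_mat[OF A_pow to_mat_carrier] B_pow, symmetric]
            assoc_mult_mat[OF A A_pow to_mat_carrier, symmetric])
      show "?T \<subseteq> ?N"
      proof
        fix X assume X: "X \<in> ?T"
        then obtain i j where "X = A ^\<^sub>m i * to_mat f * B ^\<^sub>m j" by blast
        then have "A * X \<in> ?T" using eq[of i j] by blast
        with X T span(1) show "X \<in> ?N" by blast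
      qed
      show "X + Y \<in> ?N" if "X \<in> ?N" "Y \<in> ?N" for X Y
        using that A span(4) by (auto simp: mult_add_distrib_mat[of _ m m _ n])
      show "c \<cdot>\<^sub>m X \<in> ?N" if "X \<in> ?N" for c X
        using that A span(5) by (auto simp: mult_smult_distrib[of _ m m _ n])
    qed (use A span(3) in auto)
    with that show ?thesis by blast
  qed
  have span_right: "X * B \<in> mat_span m n ?T" if "X \<in> mat_span m n ?T" for X
  proof -
    have "mat_span m n ?T \<subseteq> {X \<in> carrier_mat m n. X * B \<in> mat_span m n ?T}" (is "_ \<subseteq> ?N")
    proof (rule mat_span_minimal)
      have eq: "(A ^\<^sub>m i * to_mat f * B ^\<^sub>m j) * B = A ^\<^sub>m i * to_mat f * B ^\<^sub>m Suc j" for i j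
        using B A_pow[of i] B_pow[of j] by (simp add: assoc_mult_mat[of _ m n _ n _ n])
      show "?T \<subseteq> ?N"
      proof
        fix X assume X: "X \<in> ?T"
        then obtain i j where "X = A ^\<^sub>m i * to_mat f * B ^\<^sub>m j" by blast
        then have "X * B \<in> ?T" using eq[of i j] by blast
        with X T span(1) show "X \<in> ?N" by blast
      qed
      show "X + Y \<in> ?N" if "X \<in> ?N" "Y \<in> ?N" for X Y
        using that B span(4) by (auto simp: add_mult_distrib_mat[of _ m n])
      show "c \<cdot>\<^sub>m X \<in> ?N" if "X \<in> ?N" for c X
        using that B span(5) by (auto simp: mult_smult_assoc_mat[of _ m n])
    qed (use B span(3) in auto)
    with that show ?thesis by blast
  qed
  \<comment> \<open>The span pulled back to functions, where the closure property of
    \<open>biact\<close> applies.\<close>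
  define U where "U = {g \<in> V. to_mat g \<in> mat_span m n ?T}"
  have "A.subspace U"
    using V_closed span by (auto simp: A.subspace_def U_def to_mat_add to_mat_scale)
  moreover have "f \<in> U"
  proof -
    have "A ^\<^sub>m 0 * to_mat f * B ^\<^sub>m 0 = to_mat f"
      using A B by simp
    then have "to_mat f \<in> ?T" by (metis (mono_tags, lifting) mem_Collect_eq)
    with span(1) f show ?thesis by (auto simp: U_def)
  qed
  moreover have "lmult_fun A g \<in> U" "rmult_fun B g \<in> U" if "g \<in> U" for g
    using that span_left[of "to_mat g"] span_right[of "to_mat g"]
    by (simp_all only: U_def mem_Collect_eq to_mat_lmult to_mat_rmult V_closed simp_thms)
  ultimately have "biact r f \<in> U" for r
    by (intro biact_closed)
  then show "to_mat ` ?W \<subseteq> mat_span m n ?T"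
    by (auto simp: U_def)
qed

end

theorem theorem4p1:
  fixes A B :: "'a :: {finite, field} mat"
    and m n :: nat
  assumes "m \<ge> 1" and "n \<ge> 1"
    and "A \<in> carrier_mat m m" and "B \<in> carrier_mat n n"
    and "Factorial_Ring.irreducible (char_poly A)"
    and "Factorial_Ring.irreducible (char_poly B)"
  shows "(\<forall>S \<in> carrier_mat m n. S \<noteq> 0\<^sub>m m n \<longrightarrow>
            mat_span m n {A ^\<^sub>m i * S * B ^\<^sub>m j | i j :: nat. True} = carrier_mat m n)
         \<longleftrightarrow> gcd m n = 1"
proof -
  interpret matrix_pair A B m n
    by standard (use assms in auto)
  have deg: "degree (char_poly A) = m" "degree (char_poly B) = n"
    using degree_monic_char_poly assms by blast+
  have inj: "inj_on to_mat V" and img: "to_mat ` V = carrier_mat m n"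
    using bij_to_mat by (auto simp: bij_betw_def)
  have nonzero: "to_mat f \<noteq> 0\<^sub>m m n \<longleftrightarrow> f \<noteq> 0" if "f \<in> V" for f
    using inj_on_eq_iff[OF inj that V_closed(1)] by simp
  have full: "mat_span m n {A ^\<^sub>m i * to_mat f * B ^\<^sub>m j | i j :: nat. True} = carrier_mat m n
      \<longleftrightarrow> range (\<lambda>r. biact r f) = V" if "f \<in> V" for f
    unfolding mat_span_orbit[OF that] img[symmetric]
    by (rule inj_on_image_eq_iff[OF inj]) (use biact_V that in auto)
  \<comment> \<open>The bijection \<open>to_mat\<close> turns the condition on matrices into
    transitivity of the action on \<open>V\<close>.\<close>
  have "(\<forall>S \<in> carrier_mat m n. S \<noteq> 0\<^sub>m m n \<longrightarrow>
            mat_span m n {A ^\<^sub>m i * S * B ^\<^sub>m j | i j :: nat. True} = carrier_mat m n)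
      \<longleftrightarrow> (\<forall>f\<in>V. f \<noteq> 0 \<longrightarrow> range (\<lambda>r. biact r f) = V)"
    unfolding img[symmetric] ball_simps using nonzero full by (simp add: img)
  also have "\<dots> \<longleftrightarrow> gcd m n = 1"
    using coprime_imp_transitive transitive_imp_coprime deg by metis
  finally show ?thesis .
qed

end
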